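(* Let $n\neq 1$ be an odd positive integer such that $2^n-1$ is squarefree. Then $\ell_{\mathbb{F}_{2^n}} \geq 3(2^n-1)$.
   Context: Let $A$ be a commutative unital ring ($0_A\neq 1_A$). For $a_1,\ldots,a_n\in A$ set $M_n(a_1,\ldots,a_n)=\begin{pmatrix} a_n & -1_A\\ 1_A & 0_A\end{pmatrix}\cdots\begin{pmatrix} a_1 & -1_A\\ 1_A & 0_A\end{pmatrix}$. An $n$-tuple $(a_1,\ldots,a_n)\in A^n$ is a $\lambda$-quiddity (solution of $(E_A)$) if $M_n(a_1,\ldots,a_n)=\pm \mathrm{Id}$. For tuples, $(a_1,\ldots,a_n)\oplus(b_1,\ldots,b_m)=(a_1+b_m,a_2,\ldots,a_{n-1},a_n+b_1,b_2,\ldots,b_{m-1})$. Write $(a_1,\ldots,a_n)\sim(b_1,\ldots,b_n)$ if $(b_1,\ldots,b_n)$ is obtained from $(a_1,\ldots,a_n)$ or from $(a_n,\ldots,a_1)$ by a cyclic permutation. A $\lambda$-quiddity $(c_1,\ldots,c_n)$ with $n\geq 3$ is reducible if there exist a $\lambda$-quiddity $(b_1,\ldots,b_l)$ and a tuple $(a_1,\ldots,a_m)$ of elements of $A$ with $l,m\geq 3$ and $(c_1,\ldots,c_n)\sim(a_1,\ldots,a_m)\oplus(b_1,\ldots,b_l)$; otherwise it is irreducible. When $A$ is finite, there are only finitely many irreducible $\lambda$-quiddities over $A$, and $\ell_A$ denotes the maximal size of an irreducible $\lambda$-quiddity over $A$. $\mathbb{F}_q$ is the finite field with $q$ elements. 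*)

theory Defs
  imports "HOL-Analysis.Determinants" "HOL-Computational_Algebra.Squarefree"
begin

text \<open>Tuples over the ring are lists. The class \<open>comm_ring_1\<close> includes \<open>0 \<noteq> 1\<close>.\<close>

definition elem_mat :: "'a::comm_ring_1 \<Rightarrow> 'a^2^2" where
  "elem_mat a = vector [vector [a, - 1], vector [1, 0]]"

text \<open>The factor of the first entry is the rightmost one.\<close>

primrec M_mat :: "'a::comm_ring_1 list \<Rightarrow> 'a^2^2" where
  "M_mat [] = mat 1"
| "M_mat (a # as) = M_mat as ** elem_mat a"

definition quiddity :: "'a::comm_ring_1 list \<Rightarrow> bool" where
  "quiddity c \<longleftrightarrow> M_mat c = mat 1 \<or> M_mat c = - mat 1"

text \<open>Meaningful only when both arguments have length at least 2; below it is used only for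
  lengths at least 3.\<close>

definition tuple_sum :: "'a::comm_ring_1 list \<Rightarrow> 'a list \<Rightarrow> 'a list" where
  "tuple_sum a b =
     [hd a + last b] @ butlast (tl a) @ [last a + hd b] @ butlast (tl b)"

definition tuple_equiv :: "'a list \<Rightarrow> 'a list \<Rightarrow> bool" where
  "tuple_equiv a b \<longleftrightarrow> (\<exists>k. b = rotate k a \<or> b = rotate k (rev a))"

definition reducible_quiddity :: "'a::comm_ring_1 list \<Rightarrow> bool" where
  "reducible_quiddity c \<longleftrightarrow> quiddity c \<and> length c \<ge> 3 \<and>
     (\<exists>a b. quiddity b \<and> length b \<ge> 3 \<and> length a \<ge> 3 \<and> tuple_equiv c (tuple_sum a b))"

definition irreducible_quiddity :: "'a::comm_ring_1 list \<Rightarrow> bool" where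
  "irreducible_quiddity c \<longleftrightarrow> quiddity c \<and> length c \<ge> 3 \<and> \<not> reducible_quiddity c"

text \<open>Over a finite ring the set below is finite, and it contains 3 because of \<open>[1, 1, 1]\<close>;
  hence the maximum is attained.\<close>

definition max_irreducible_size :: "'a::{comm_ring_1, finite} itself \<Rightarrow> nat" where
  "max_irreducible_size _ = Max {length c |c :: 'a list. irreducible_quiddity c}"

end

theory Submission
  imports Defs "HOL-Computational_Algebra.Polynomial" "HOL-Library.Disjoint_Sets"
begin

text \<open>A reducible quiddity has a cyclic subword, of length between 1 and its own length minus 3,
  whose matrix has upper left entry \<open>\<plusminus>1\<close>. Over a field with \<open>q = 2\<^sup>n\<close> elements, take
  the tuple \<open>(t, t\<^sup>-\<^sup>1, t)\<close> repeated \<open>q - 1\<close> times, with \<open>t\<close> of multiplicative order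
  \<open>q - 1\<close>: the block has matrix \<open>diag(t, t\<^sup>-\<^sup>1)\<close>, and the upper left entries of the
  subwords are 0, \<open>t\<^sup>k\<close>, \<open>t\<^sup>-\<^sup>k\<close> or \<open>t (t\<^sup>k + t\<^sup>-\<^sup>k)\<close>. The last kind avoids 1
  as soon as \<open>y\<^sup>2 + y = t\<^sup>2\<close> has no root. Such a \<open>t\<close> exists because the elements of order
  \<open>q - 1\<close> sum to the Moebius value of \<open>q - 1\<close>, which is nonzero.\<close>

section \<open>Products of elementary matrices\<close>

lemma M_mat_append: "M_mat (xs @ ys) = M_mat ys ** M_mat xs"
  by (induction xs) (simp_all add: matrix_mul_assoc)

lemma elem_mat_mult_nth:
  "(elem_mat a ** X) $ 1 $ j = a * X $ 1 $ j - X $ 2 $ j"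
  "(elem_mat a ** X) $ 2 $ j = X $ 1 $ j"
  by (simp_all add: matrix_matrix_mult_def elem_mat_def sum_2)

lemma mult_elem_mat_nth:
  "(X ** elem_mat a) $ i $ 1 = X $ i $ 1 * a + X $ i $ 2"
  "(X ** elem_mat a) $ i $ 2 = - X $ i $ 1"
  by (simp_all add: matrix_matrix_mult_def elem_mat_def sum_2)

lemma M_mat_snoc_nth:
  "M_mat (xs @ [a]) $ 1 $ j = a * M_mat xs $ 1 $ j - M_mat xs $ 2 $ j"
  "M_mat (xs @ [a]) $ 2 $ j = M_mat xs $ 1 $ j"
  by (simp_all add: M_mat_append elem_mat_mult_nth)

lemma mat_2_eq_iff:
  "(X :: 'a^2^2) = Y \<longleftrightarrow>
     X $ 1 $ 1 = Y $ 1 $ 1 \<and> X $ 1 $ 2 = Y $ 1 $ 2 \<and>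
     X $ 2 $ 1 = Y $ 2 $ 1 \<and> X $ 2 $ 2 = Y $ 2 $ 2"
  by (auto simp: vec_eq_iff forall_2)

lemma mat_2_nth:
  "(mat 1 :: 'a::comm_ring_1^2^2) $ 1 $ 1 = 1" "(mat 1 :: 'a^2^2) $ 1 $ 2 = 0"
  "(mat 1 :: 'a^2^2) $ 2 $ 1 = 0" "(mat 1 :: 'a^2^2) $ 2 $ 2 = 1"
  by (simp_all add: mat_def)

text \<open>Gluing alters only the end entries of \<open>b\<close>, so its interior survives as a
  cyclic subword of the sum. Stripping the two end factors turns the lower right entry of
  \<open>M_mat b\<close> into minus the upper left entry of the interior.\<close>

lemma quiddity_interior:
  fixes b :: "'a::comm_ring_1 list"
  assumes "quiddity b" and "length b \<ge> 2"
  shows "M_mat (butlast (tl b)) $ 1 $ 1 = 1 \<or> M_mat (butlast (tl b)) $ 1 $ 1 = - 1"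
proof -
  obtain x b' where b': "b = x # b'" "b' \<noteq> []"
    using assms(2) by (cases b; cases "tl b") auto
  define w where "w = butlast (tl b)"
  have "b' = w @ [last b']"
    using b' by (simp add: w_def)
  then have "M_mat b = M_mat (w @ [last b']) ** elem_mat x"
    using b' by (metis M_mat.simps(2))
  then have "M_mat b $ 2 $ 2 = - M_mat w $ 1 $ 1"
    by (simp add: mult_elem_mat_nth M_mat_snoc_nth)
  moreover have "M_mat b $ 2 $ 2 = 1 \<or> M_mat b $ 2 $ 2 = - 1"
    using assms(1) by (auto simp: quiddity_def mat_2_nth)
  ultimately show ?thesis
    unfolding w_def by (metis minus_minus)
qed

section \<open>Finiteness\<close>

text \<open>The square of \<open>elem_mat 0\<close> is \<open>- mat 1\<close>, so the padding only
  flips the sign.\<close>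

lemma quiddity_pad_zeros:
  fixes w :: "'a::comm_ring_1 list"
  assumes "M_mat w = mat 1"
  shows "quiddity ([0] @ w @ [0])"
  using assms by (simp add: quiddity_def M_mat_append mat_2_eq_iff mat_2_nth
      elem_mat_mult_nth mult_elem_mat_nth)

lemma invertible_elem_mat: "invertible (elem_mat a)"
proof -
  define B :: "'a^2^2" where "B = vector [vector [0, 1], vector [- 1, a]]"
  have "elem_mat a ** B = mat 1" "B ** elem_mat a = mat 1"
    by (simp_all add: B_def mat_2_eq_iff mat_2_nth elem_mat_mult_nth mult_elem_mat_nth)
  then show ?thesis
    by (auto simp: invertible_def)
qed

lemma invertible_M_mat: "invertible (M_mat xs)"
proof (induction xs)
  case Nil
  have "(mat 1 :: 'a^2^2) ** mat 1 = mat 1" by simp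
  then show ?case unfolding invertible_def M_mat.simps by blast
next
  case (Cons a xs)
  then show ?case by (simp add: invertible_mult invertible_elem_mat)
qed

text \<open>The padding zeros add nothing to the glued ends, so the sum of \<open>ys @ xs\<close>
  and \<open>[0] @ w @ [0]\<close> is \<open>ys @ xs @ w\<close>, a rotation of
  \<open>c\<close>.\<close>

lemma quiddity_reducible_if_block_trivial:
  fixes c :: "'a::comm_ring_1 list"
  assumes c: "c = xs @ w @ ys" "quiddity c"
    and w: "w \<noteq> []" "M_mat w = mat 1" and len: "length xs + length ys \<ge> 3"
  shows "reducible_quiddity c"
proof -
  define a b where "a = ys @ xs" and "b = [0] @ w @ [0]"
  have la: "length a \<ge> 3" using len by (simp add: a_def)
  then obtain x a' where a': "a = x # a'" "a' \<noteq> []"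
    by (cases a; cases "tl a") auto
  have "tuple_sum a b = a @ w"
    using a' by (simp add: tuple_sum_def b_def)
  also have "\<dots> = rotate (length (xs @ w)) ((xs @ w) @ ys)"
    unfolding rotate_append by (simp add: a_def)
  finally have "tuple_equiv c (tuple_sum a b)"
    unfolding tuple_equiv_def c(1) by auto
  moreover have "quiddity b"
    unfolding b_def using w(2) by (rule quiddity_pad_zeros)
  moreover have "length b \<ge> 3"
    using w(1) by (cases w) (simp_all add: b_def)
  moreover have "length c \<ge> 3"
    using c(1) len by simp
  ultimately show ?thesis
    unfolding reducible_quiddity_def using c(2) la by blast
qed

text \<open>By pigeonhole two prefixes of a longer tuple share a matrix; cancelling it leaves a
  block with trivial matrix.\<close>

lemma length_irreducible_quiddity_le:
  fixes c :: "'a::{comm_ring_1, finite} list"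
  assumes "irreducible_quiddity c"
  shows "length c \<le> CARD('a^2^2) + 2"
proof (rule ccontr)
  assume "\<not> length c \<le> CARD('a^2^2) + 2"
  \<comment> \<open>Stopping the prefixes at \<open>length c - 3\<close> keeps three entries outside
    the block for the left summand.\<close>
  then have len: "card {0..length c - 3} > CARD('a^2^2)" by simp
  have "card ((\<lambda>i. M_mat (take i c)) ` {0..length c - 3}) \<le> CARD('a^2^2)"
    by (intro card_mono) auto
  then have "\<not> inj_on (\<lambda>i. M_mat (take i c)) {0..length c - 3}"
    using len pigeonhole by (metis le_less_trans)
  then obtain i j where ij: "i < j" "j \<le> length c - 3" "M_mat (take i c) = M_mat (take j c)"
    unfolding inj_on_def by (metis atLeastAtMost_iff linorder_neqE_nat)
  define w where "w = take (j - i) (drop i c)"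
  have j: "take j c = take i c @ w"
    using ij(1) take_add[of i "j - i" c] by (simp add: w_def)
  then have eq: "M_mat w ** M_mat (take i c) = M_mat (take i c)"
    using ij(3) by (simp add: M_mat_append)
  obtain B where B: "M_mat (take i c) ** B = mat 1"
    using invertible_M_mat unfolding invertible_def by blast
  have "M_mat w = M_mat w ** (M_mat (take i c) ** B)"
    using B by simp
  also have "\<dots> = M_mat w ** M_mat (take i c) ** B"
    by (simp only: matrix_mul_assoc)
  also have "\<dots> = mat 1"
    using eq B by simp
  finally have "M_mat w = mat 1" .
  moreover have "c = take i c @ w @ drop j c"
    using j by (metis append.assoc append_take_drop_id)
  moreover have "w \<noteq> []"
    using ij(1,2) assms by (simp add: w_def irreducible_quiddity_def)
  moreover have "length (take i c) + length (drop j c) \<ge> 3"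
    using ij(1,2) assms by (simp add: irreducible_quiddity_def)
  ultimately have "reducible_quiddity c"
    using assms quiddity_reducible_if_block_trivial unfolding irreducible_quiddity_def by blast
  then show False
    using assms by (simp add: irreducible_quiddity_def)
qed

text \<open>\<open>Max\<close> is known to bound its members only on a finite set; the preceding
  length bound gives finiteness.\<close>

lemma length_irreducible_quiddity_le_max:
  fixes c :: "'a::{comm_ring_1, finite} list"
  assumes "irreducible_quiddity c"
  shows "length c \<le> max_irreducible_size TYPE('a)"
proof -
  have "{length c |c :: 'a list. irreducible_quiddity c} \<subseteq> {..CARD('a^2^2) + 2}"
    using length_irreducible_quiddity_le by auto
  then have "finite {length c |c :: 'a list. irreducible_quiddity c}"
    using finite_subset by blast
  then show ?thesis
    unfolding max_irreducible_size_def using assms by (intro Max_ge) auto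
qed

section \<open>Elements of maximal order in a finite field\<close>

text \<open>Multiplication by \<open>x\<close> permutes the nonzero elements, so it preserves their
  product.\<close>

lemma finite_field_power_card_minus_1:
  fixes x :: "'a::{field, finite}"
  assumes "x \<noteq> 0"
  shows "x ^ (CARD('a) - 1) = 1"
proof -
  have "(\<Prod>y\<in>UNIV - {0}. y) = (\<Prod>y\<in>UNIV - {0 :: 'a}. x * y)"
    by (rule prod.reindex_bij_witness[of _ "\<lambda>y. x * y" "\<lambda>y. y / x"]) (use assms in auto)
  also have "\<dots> = x ^ (CARD('a) - 1) * (\<Prod>y\<in>UNIV - {0}. y)"
    by (simp add: prod.distrib)
  finally show ?thesis
    by simp
qed

lemma finite_field_even_card_imp_char_2:
  assumes "even CARD('a::{field, finite})"
  shows "(1 + 1 :: 'a) = 0"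
proof -
  have "(- 1 :: 'a) ^ (CARD('a) - 1) = 1"
    by (rule finite_field_power_card_minus_1) simp
  moreover have "odd (CARD('a) - 1)"
    using assms by simp
  ultimately have "(- 1 :: 'a) = 1" by simp
  then show ?thesis by (metis add.right_inverse)
qed

text \<open>Stating the order through divisibility makes uniqueness immediate; \<open>d = 0\<close>
  means that no positive power is 1.\<close>

definition has_mult_order :: "'a::field \<Rightarrow> nat \<Rightarrow> bool" where
  "has_mult_order x d \<longleftrightarrow> (\<forall>e. x ^ e = 1 \<longleftrightarrow> d dvd e)"

lemma has_mult_order_exists:
  assumes "x ^ k = 1" and "k > 0"
  shows "\<exists>d. d dvd k \<and> has_mult_order x d"
proof -
  define d where "d = (LEAST d. d > 0 \<and> x ^ d = 1)"
  have d: "d > 0" "x ^ d = 1"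
    using LeastI[of "\<lambda>d. d > 0 \<and> x ^ d = 1" k] assms unfolding d_def by auto
  have least: "\<not> (e > 0 \<and> x ^ e = 1)" if "e < d" for e
    using that not_less_Least unfolding d_def by blast
  have "x ^ e = x ^ (e mod d)" for e
  proof -
    have "x ^ e = x ^ (d * (e div d) + e mod d)" by simp
    also have "\<dots> = x ^ (e mod d)"
      using d(2) by (simp only: power_add power_mult power_one mult_1_left)
    finally show ?thesis .
  qed
  then have "x ^ e = 1 \<longleftrightarrow> d dvd e" for e
    using least[of "e mod d"] d(1) by (metis dvd_eq_mod_eq_0 mod_less_divisor neq0_conv power_0)
  then show ?thesis
    using assms(1) unfolding has_mult_order_def by blast
qed

lemma has_mult_order_unique:
  assumes "has_mult_order x d" "has_mult_order x e"
  shows "d = e"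
  using assms unfolding has_mult_order_def by (metis dvd_antisym dvd_refl)

text \<open>With \<open>q - 1 = k * e\<close>, the polynomial \<open>X^e - 1\<close> has at most
  \<open>e < q - 1\<close> roots; take \<open>y = x^e\<close> for a nonzero non-root
  \<open>x\<close>.\<close>

lemma exists_nontrivial_root_of_unity:
  assumes "k dvd CARD('a::{field, finite}) - 1" and "k > 1"
  shows "\<exists>y :: 'a. y \<noteq> 1 \<and> y ^ k = 1"
proof -
  define m where "m = CARD('a) - 1"
  obtain e where e: "m = k * e"
    using assms(1) unfolding m_def by (elim dvdE)
  have m: "m = card (UNIV - {0 :: 'a})"
    by (simp add: m_def)
  have "card {0 :: 'a, 1} \<le> CARD('a)"
    by (rule card_mono) auto
  then have "m > 0" by (simp add: m_def)
  then have e0: "e > 0" "e < m"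
    using e assms(2) by auto
  define p :: "'a poly" where "p = monom 1 e + [:- 1:]"
  have deg: "degree p = e"
    unfolding p_def using e0(1) by (subst degree_add_eq_left) (simp_all add: degree_monom_eq)
  then have "p \<noteq> 0" using e0(1) by auto
  then have "card {x. poly p x = 0} < m"
    using card_poly_roots_bound[of p] deg e0(2) by simp
  then have "\<not> UNIV - {0} \<subseteq> {x. poly p x = 0}"
    using m card_mono[of "{x. poly p x = 0}" "UNIV - {0}"] by auto
  then obtain x :: 'a where x: "x \<noteq> 0" "x ^ e \<noteq> 1"
    by (auto simp: p_def poly_monom)
  have "(x ^ e) ^ k = 1"
    using finite_field_power_card_minus_1[OF x(1)] e
    by (simp add: m_def power_mult[symmetric] mult.commute)
  then show ?thesis using x(2) by blast
qed

text \<open>Multiplication by \<open>y\<close> permutes the roots, so the sum is fixed by a factor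
  other than 1.\<close>

lemma sum_roots_of_unity:
  fixes y :: "'a::{field, finite}"
  assumes "y ^ k = 1" "y \<noteq> 1" "k > 0"
  shows "\<Sum>{x :: 'a. x ^ k = 1} = 0"
proof -
  have "y \<noteq> 0" using assms(1,3) by (auto simp: power_0_left)
  then have "\<Sum>{x :: 'a. x ^ k = 1} = (\<Sum>x | x ^ k = 1. y * x)"
    by (intro sum.reindex_bij_witness[of _ "\<lambda>x. y * x" "\<lambda>x. x / y"])
      (use assms(1) in \<open>auto simp: power_mult_distrib power_divide\<close>)
  also have "\<dots> = y * \<Sum>{x :: 'a. x ^ k = 1}"
    by (simp add: sum_distrib_left)
  finally have "(y - 1) * \<Sum>{x :: 'a. x ^ k = 1} = 0"
    by (simp add: left_diff_distrib)
  then show ?thesis using assms(2) by simp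
qed

text \<open>For \<open>k\<close> dividing \<open>q - 1\<close>, the elements of order \<open>k\<close> sum to the Moebius value of \<open>k\<close>;
  for squarefree \<open>k\<close> and characteristic 2 this is 1.\<close>

lemma sum_elements_of_order:
  assumes char: "(1 + 1 :: 'a::{field, finite}) = 0"
    and "k dvd CARD('a) - 1" and "squarefree k"
  shows "\<Sum>{x :: 'a. has_mult_order x k} = 1"
  using assms(2,3)
proof (induction k rule: less_induct)
  case (less k)
  define S where "S d = \<Sum>{x :: 'a. has_mult_order x d}" for d
  have k0: "k > 0" using less.prems(2) by (cases "k = 0") auto
  show ?case
  proof (cases "k = 1")
    case True
    have "has_mult_order x 1 \<longleftrightarrow> x = 1" for x :: 'a
      unfolding has_mult_order_def by (metis one_dvd power_one power_one_right)
    then show ?thesis using True by simp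
  next
    case False
    then have k1: "k > 1" using k0 by simp
    obtain y :: 'a where y: "y \<noteq> 1" "y ^ k = 1"
      using exists_nontrivial_root_of_unity[OF less.prems(1) k1] by blast
    let ?D = "{d. d dvd k}"
    have fin: "finite ?D" using k0 by simp
    \<comment> \<open>Sorting the \<open>k\<close>-th roots of unity by order splits their zero sum
      into the values \<open>S d\<close>.\<close>
    have "{x :: 'a. x ^ k = 1} = (\<Union>d\<in>?D. {x. has_mult_order x d})"
      using has_mult_order_exists[OF _ k0] unfolding has_mult_order_def by blast
    then have "\<Sum>{x :: 'a. x ^ k = 1} = (\<Sum>d\<in>?D. S d)"
      unfolding S_def using fin has_mult_order_unique
      by (simp only:) (rule sum.UNION_disjoint; auto)
    then have "(\<Sum>d\<in>?D. S d) = 0"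
      using sum_roots_of_unity[OF y(2,1) k0] by simp
    moreover have "(\<Sum>d\<in>?D. S d) = S k + (\<Sum>d\<in>?D - {k}. S d)"
      using fin by (simp add: sum.remove)
    moreover have "(\<Sum>d\<in>?D - {k}. S d) = (\<Sum>d\<in>?D - {k}. 1)"
    proof (rule sum.cong)
      fix d assume "d \<in> ?D - {k}"
      then have "d < k" "d dvd k" using k0 by (auto dest: dvd_imp_le)
      then show "S d = 1"
        unfolding S_def using less.prems less.IH[of d] squarefree_mono dvd_trans by blast
    qed simp
    moreover have "(\<Sum>d\<in>?D. 1 :: 'a) = 1 + (\<Sum>d\<in>?D - {k}. 1)"
      using fin by (subst sum.remove[of _ k]) simp_all
    \<comment> \<open>Divisors pair off under \<open>d\<close> to \<open>k div d\<close>, as a fixed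
      point would make \<open>k\<close> a square. Both the values \<open>S d\<close> and the
      constant 1 thus sum to 0 and agree on proper divisors, hence also at \<open>k\<close>.\<close>
    moreover have "(\<Sum>d\<in>?D. 1 :: 'a) = 0"
    proof (rule sum_involution_eq_0[where h = "\<lambda>d. k div d"])
      fix d assume "d \<in> ?D"
      then have d: "d dvd k" by simp
      show "(1 + 1 :: 'a) = 0" by (fact char)
      show "k div d \<in> ?D" using d by auto
      show "k div (k div d) = d" using d k0 by auto
      show "k div d \<noteq> d"
      proof
        assume "k div d = d"
        then have "k = d ^ 2" using d by (metis dvd_mult_div_cancel power2_eq_square)
        then have "d dvd 1" using squarefreeD[OF less.prems(2), of d] by simp
        then show False using \<open>k = d ^ 2\<close> k1 by simp
      qed
    qed
    ultimately show ?thesis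
      unfolding S_def by (metis add_right_cancel)
  qed
qed

lemma char_2_add_self:
  fixes x :: "'a::comm_ring_1"
  assumes "(1 + 1 :: 'a) = 0"
  shows "x + x = 0"
  by (metis assms distrib_left mult.right_neutral mult_zero_right)

text \<open>The values \<open>y\<^sup>2 + y\<close> form an additive subgroup missing 1, since
  \<open>y\<^sup>2 + y = 1\<close> makes \<open>y\<close> a primitive cube root of unity. As the squares of the elements of
  maximal order sum to 1, they cannot all lie in this subgroup.\<close>

lemma exists_maximal_order_not_artin_schreier:
  assumes "CARD('a::{field, finite}) = 2 ^ n" and "odd n" and "squarefree (2 ^ n - 1 :: nat)"
  shows "\<exists>t :: 'a. has_mult_order t (2 ^ n - 1) \<and> (\<forall>y. y\<^sup>2 + y \<noteq> t\<^sup>2)"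
proof (rule ccontr)
  assume contr: "\<not> ?thesis"
  have n0: "n > 0" using assms(2) by (rule odd_pos)
  have char: "(1 + 1 :: 'a) = 0"
    by (rule finite_field_even_card_imp_char_2) (use assms(1) n0 in simp)
  have add_self: "x + x = 0" for x :: 'a
    using char by (rule char_2_add_self)
  define H where "H = {y\<^sup>2 + y |y :: 'a. True}"
  have square_add: "(x + y)\<^sup>2 = x\<^sup>2 + y\<^sup>2" for x y :: 'a
    using add_self[of "x * y"] by (simp add: power2_eq_square algebra_simps)
  have H_0: "0 \<in> H"
    unfolding H_def by (auto intro: exI[of _ 0])
  have H_add: "u + v \<in> H" if uv: "u \<in> H" "v \<in> H" for u v
  proof -
    obtain x y where "u = x\<^sup>2 + x" "v = y\<^sup>2 + y"
      using uv unfolding H_def by blast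
    then have "u + v = (x + y)\<^sup>2 + (x + y)"
      by (simp add: square_add)
    then show ?thesis unfolding H_def by blast
  qed
  define P where "P = {x :: 'a. has_mult_order x (2 ^ n - 1)}"
  have "(\<Sum>x\<in>A. x\<^sup>2) \<in> H" if "A \<subseteq> P" for A
    using finite[of A] that
  proof (induction A rule: finite_induct)
    case (insert x A)
    then have "has_mult_order x (2 ^ n - 1)" by (simp add: P_def)
    then obtain y where "y\<^sup>2 + y = x\<^sup>2" using contr by blast
    then have "x\<^sup>2 \<in> H" unfolding H_def by (metis (mono_tags, lifting) mem_Collect_eq)
    then show ?case using insert H_add by simp
  qed (use H_0 in simp)
  then have "(\<Sum>x\<in>P. x\<^sup>2) \<in> H" by blast
  \<comment> \<open>Squaring is additive here, so the squares over \<open>P\<close> sum to the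
    square of 1.\<close>
  moreover have "(\<Sum>x\<in>A. x\<^sup>2) = (\<Sum>A)\<^sup>2" for A :: "'a set"
    using finite[of A] by (induction A rule: finite_induct) (simp_all add: square_add)
  moreover have "\<Sum>P = 1"
    unfolding P_def using sum_elements_of_order[OF char] assms(1,3) by simp
  ultimately have "1 \<in> H" by simp
  then obtain y :: 'a where y: "y\<^sup>2 + y = 1" unfolding H_def by force
  have "y ^ 3 = y * (y\<^sup>2 + y) - (y\<^sup>2 + y) + y"
    by (simp add: power2_eq_square power3_eq_cube algebra_simps)
  also have "\<dots> = (y + y) + 1 - (1 + 1)"
    by (simp add: y)
  finally have y3: "y ^ 3 = 1"
    by (simp only: add_self add_0_left diff_zero)
  have "y \<noteq> 1" "y \<noteq> 0" using y char by auto
  obtain k where k: "n = 2 * k + 1" using assms(2) by (elim oddE)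
  \<comment> \<open>For odd \<open>n\<close> the exponent \<open>2^n - 1\<close> is 1 modulo 3, so
    raising the cube root of unity \<open>y\<close> to it returns \<open>y\<close> instead of
    1.\<close>
  have "(2 ^ (2 * k + 1) :: nat) mod 3 = 2"
  proof (induction k)
    case (Suc k)
    have "(4 * p) mod 3 = p mod 3" for p :: nat by presburger
    from this[of "2 ^ (2 * k + 1)"] show ?case using Suc by simp
  qed simp
  then obtain q where "2 ^ n = 3 * q + (2 :: nat)"
    unfolding k by (metis mult_div_mod_eq)
  then have "2 ^ n - 1 = 3 * q + (1 :: nat)" by simp
  then have "y ^ (2 ^ n - 1) = y"
    by (simp add: power_add power_mult y3)
  then show False
    using finite_field_power_card_minus_1[OF \<open>y \<noteq> 0\<close>] assms(1) \<open>y \<noteq> 1\<close> by simp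
qed

section \<open>A long irreducible quiddity\<close>

text \<open>An infinite sequence of period 3, so that cyclic subwords become index intervals without
  wrapping round.\<close>

definition periodic_entry :: "'a::field \<Rightarrow> nat \<Rightarrow> 'a" where
  "periodic_entry t j = (if j mod 3 = 1 then inverse t else t)"

lemma periodic_entry_mod: "3 dvd N \<Longrightarrow> periodic_entry t (j mod N) = periodic_entry t j"
  by (simp add: periodic_entry_def mod_mod_cancel)

lemma rotate_periodic_entries:
  "rotate k (map (periodic_entry t) [0..<3 * m]) = map (periodic_entry t) [k..<k + 3 * m]"
  by (rule nth_equalityI) (simp_all add: nth_rotate periodic_entry_mod add.commute)

text \<open>The block is a palindrome; hence the reflections in \<open>tuple_equiv\<close> give
  nothing beyond rotations.\<close>

lemma rev_periodic_entries:
  "rev (map (periodic_entry t) [0..<3 * m]) = map (periodic_entry t) [0..<3 * m]"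
proof (rule nth_equalityI)
  fix j assume "j < length (rev (map (periodic_entry t) [0..<3 * m]))"
  then have j: "j < 3 * m" by simp
  define d where "d = 3 * m - Suc j"
  have "d + j + 1 = 3 * m"
    using j by (simp add: d_def)
  then have "(3 * m - Suc j) mod 3 = 1 \<longleftrightarrow> j mod 3 = 1"
    unfolding d_def[symmetric] by presburger
  then show "rev (map (periodic_entry t) [0..<3 * m]) ! j = map (periodic_entry t) [0..<3 * m] ! j"
    using j by (simp add: rev_nth periodic_entry_def)
qed simp

section \<open>Matrices of the subwords of the periodic tuple\<close>

locale char_2_period =
  fixes t :: "'a::field"
  assumes char_2: "(1 + 1 :: 'a) = 0" and t_nonzero: "t \<noteq> 0"
begin

definition subword :: "nat \<Rightarrow> nat \<Rightarrow> 'a list" where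
  "subword i r = map (periodic_entry t) [i..<i + r]"

lemma minus_eq: "- x = (x :: 'a)"
  using char_2_add_self[OF char_2, of x] by (simp add: add_eq_0_iff)

lemma diff_eq_add: "x - y = x + (y :: 'a)"
  by (metis minus_eq diff_conv_add_uminus)

lemma cancel_self: "x + x = (0 :: 'a)" "x + (x + y) = (y :: 'a)"
  using char_2_add_self[OF char_2, of x] by (simp_all add: add.assoc[symmetric])

lemma M_mat_subword_Suc:
  "M_mat (subword i (Suc r)) $ 1 $ j =
     periodic_entry t (i + r) * M_mat (subword i r) $ 1 $ j + M_mat (subword i r) $ 2 $ j"
  "M_mat (subword i (Suc r)) $ 2 $ j = M_mat (subword i r) $ 1 $ j"
proof -
  have "subword i (Suc r) = subword i r @ [periodic_entry t (i + r)]"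
    by (simp add: subword_def)
  then show "M_mat (subword i (Suc r)) $ 1 $ j =
     periodic_entry t (i + r) * M_mat (subword i r) $ 1 $ j + M_mat (subword i r) $ 2 $ j"
    "M_mat (subword i (Suc r)) $ 2 $ j = M_mat (subword i r) $ 1 $ j"
    by (simp_all add: M_mat_snoc_nth diff_eq_add)
qed

lemma periodic_entry_add_mult:
  "periodic_entry t (i + 3 * k) = periodic_entry t i"
  "periodic_entry t (i + Suc (3 * k)) = periodic_entry t (i + 1)"
  "periodic_entry t (i + Suc (Suc (3 * k))) = periodic_entry t (i + 2)"
proof -
  have *: "periodic_entry t (j + 3 * k) = periodic_entry t j" for j
    by (simp add: periodic_entry_def)
  show "periodic_entry t (i + 3 * k) = periodic_entry t i"
    "periodic_entry t (i + Suc (3 * k)) = periodic_entry t (i + 1)"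
    "periodic_entry t (i + Suc (Suc (3 * k))) = periodic_entry t (i + 2)"
    using *[of i] *[of "i + 1"] *[of "i + 2"] by simp_all
qed

lemma periodic_entry_values:
  assumes "i mod 3 = e"
  shows "periodic_entry t i = (if e = 1 then inverse t else t)"
    "periodic_entry t (i + 1) = (if e = 0 then inverse t else t)"
    "periodic_entry t (i + 2) = (if e = 2 then inverse t else t)"
proof -
  have *: "(i + 1) mod 3 = 1 \<longleftrightarrow> e = 0" "(i + 2) mod 3 = 1 \<longleftrightarrow> e = 2"
    using assms by presburger+
  show "periodic_entry t i = (if e = 1 then inverse t else t)"
    "periodic_entry t (i + 1) = (if e = 0 then inverse t else t)"
    "periodic_entry t (i + 2) = (if e = 2 then inverse t else t)"
    using assms unfolding periodic_entry_def * by simp_all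
qed

lemmas subword_simps = M_mat_subword_Suc periodic_entry_add_mult

text \<open>Reduces every length to whole blocks, of which only the first column matters.\<close>

lemma M_mat_subword_add:
  "M_mat (subword i (3 * k + 1)) $ 1 $ 1 =
     periodic_entry t i * M_mat (subword i (3 * k)) $ 1 $ 1 + M_mat (subword i (3 * k)) $ 2 $ 1"
  "M_mat (subword i (3 * k + 2)) $ 1 $ 1 =
     periodic_entry t (i + 1) * (periodic_entry t i * M_mat (subword i (3 * k)) $ 1 $ 1 +
       M_mat (subword i (3 * k)) $ 2 $ 1) + M_mat (subword i (3 * k)) $ 1 $ 1"
proof -
  have "3 * k + 1 = Suc (3 * k)" "3 * k + 2 = Suc (Suc (3 * k))" by simp_all
  then show "M_mat (subword i (3 * k + 1)) $ 1 $ 1 =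
     periodic_entry t i * M_mat (subword i (3 * k)) $ 1 $ 1 + M_mat (subword i (3 * k)) $ 2 $ 1"
    "M_mat (subword i (3 * k + 2)) $ 1 $ 1 =
     periodic_entry t (i + 1) * (periodic_entry t i * M_mat (subword i (3 * k)) $ 1 $ 1 +
       M_mat (subword i (3 * k)) $ 2 $ 1) + M_mat (subword i (3 * k)) $ 1 $ 1"
    by (simp_all only: subword_simps)
qed

lemma subword_0: "subword i 0 = []"
  by (simp add: subword_def)

text \<open>Each block contributes \<open>diag(t, inverse t)\<close>. The second column serves to
  show that the full tuple is a quiddity.\<close>

lemma M_mat_subword_0:
  assumes "i mod 3 = 0"
  shows "M_mat (subword i (3 * k)) $ 1 $ 1 = t ^ k \<and> M_mat (subword i (3 * k)) $ 2 $ 1 = 0 \<and>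
    M_mat (subword i (3 * k)) $ 1 $ 2 = 0 \<and> M_mat (subword i (3 * k)) $ 2 $ 2 = inverse t ^ k"
proof (induction k)
  case 0
  show ?case by (simp add: subword_0 mat_2_nth)
next
  case (Suc k)
  have "3 * Suc k = Suc (Suc (Suc (3 * k)))" by simp
  then show ?case
    using Suc t_nonzero
    by (simp only: subword_simps periodic_entry_values[OF assms])
      (simp add: cancel_self field_simps)
qed

text \<open>The shifted block \<open>inverse t, t, t\<close> has an upper triangular matrix with
  upper left entry \<open>inverse t\<close>.\<close>

lemma M_mat_subword_1:
  assumes "i mod 3 = 1"
  shows "M_mat (subword i (3 * k)) $ 1 $ 1 = inverse t ^ k \<and> M_mat (subword i (3 * k)) $ 2 $ 1 = 0"
proof (induction k)
  case 0
  show ?case by (simp add: subword_0 mat_2_nth)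
next
  case (Suc k)
  have "3 * Suc k = Suc (Suc (Suc (3 * k)))" by simp
  then show ?case
    using Suc t_nonzero
    by (simp only: subword_simps periodic_entry_values[OF assms])
      (simp add: cancel_self field_simps)
qed

text \<open>The block \<open>t, t, inverse t\<close> has a lower triangular matrix with lower left
  entry \<open>t^2 + 1\<close>; in its powers these contributions telescope.\<close>

lemma M_mat_subword_2:
  assumes "i mod 3 = 2"
  shows "M_mat (subword i (3 * k)) $ 1 $ 1 = inverse t ^ k \<and>
    M_mat (subword i (3 * k)) $ 2 $ 1 = t * (t ^ k + inverse t ^ k)"
proof (induction k)
  case 0
  show ?case by (simp add: subword_0 mat_2_nth cancel_self)
next
  case (Suc k)
  have "3 * Suc k = Suc (Suc (Suc (3 * k)))" by simp
  then show ?case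
    using Suc t_nonzero
    by (simp only: subword_simps periodic_entry_values[OF assms])
      (simp add: cancel_self field_simps)
qed

lemma quiddity_subword:
  assumes "t ^ m = 1"
  shows "quiddity (subword 0 (3 * m))"
  using M_mat_subword_0[of 0 m] assms
  by (simp add: quiddity_def mat_2_eq_iff mat_2_nth power_inverse)

lemma M_mat_subword_neq_1:
  assumes order: "has_mult_order t m" and no_root: "\<And>y. y\<^sup>2 + y \<noteq> t\<^sup>2"
    and r: "0 < r" "r + 3 \<le> 3 * m"
  shows "M_mat (subword i r) $ 1 $ 1 \<noteq> 1"
proof -
  define k e where "k = r div 3" and "e = r mod 3"
  have r_eq: "r = 3 * k + e" and "e < 3" by (simp_all add: k_def e_def)
  have power_neq: "t ^ d \<noteq> 1" if "0 < d" "d < m" for d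
    using order that unfolding has_mult_order_def by (auto dest: dvd_imp_le)
  have inverse_neq: "inverse t ^ d \<noteq> 1" if "0 < d" "d < m" for d
    using power_neq[OF that] by (simp add: power_inverse)
  \<comment> \<open>Equality would make \<open>y = t * t ^ d\<close> a root of
    \<open>y^2 + y = t^2\<close>.\<close>
  have mixed_neq: "t * (t ^ d + inverse t ^ d) \<noteq> 1" for d
  proof
    assume "t * (t ^ d + inverse t ^ d) = 1"
    then have "t * (t ^ d * t ^ d + 1) = t ^ d"
      using t_nonzero by (simp add: field_simps)
    then have "(t * t ^ d)\<^sup>2 + t * t ^ d = (t * t ^ d)\<^sup>2 + t * (t * (t ^ d * t ^ d + 1))"
      by simp
    also have "\<dots> = t\<^sup>2"
      by (simp add: power2_eq_square algebra_simps cancel_self)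
    finally show False using no_root by blast
  qed
  \<comment> \<open>The margin of 3 in \<open>r + 3 \<le> 3 * m\<close> keeps each relevant exponent
    strictly between 0 and \<open>m\<close>.\<close>
  consider "e = 0" "0 < k" "k < m" | "e = 1" "k + 1 < m" | "e = 2" "k + 1 < m"
    using r r_eq \<open>e < 3\<close> by linarith
  then have e: "e = 0 \<and> t ^ k \<noteq> 1 \<and> inverse t ^ k \<noteq> 1 \<or>
    (e = 1 \<or> e = 2) \<and> t ^ (k + 1) \<noteq> 1 \<and> inverse t ^ (k + 1) \<noteq> 1"
    by cases (use power_neq[of k] inverse_neq[of k] power_neq[of "k + 1"] inverse_neq[of "k + 1"] in auto)
  consider "i mod 3 = 0" | "i mod 3 = 1" | "i mod 3 = 2"
    by linarith
  then show ?thesis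
  proof cases
    case 1
    have "M_mat (subword i (3 * k + 1)) $ 1 $ 1 = t ^ (k + 1)"
      using M_mat_subword_0[OF 1, of k] t_nonzero
      by (simp only: M_mat_subword_add periodic_entry_values[OF 1])
        (simp add: cancel_self field_simps)
    moreover have "M_mat (subword i (3 * k + 2)) $ 1 $ 1 = 0"
      using M_mat_subword_0[OF 1, of k] t_nonzero
      by (simp only: M_mat_subword_add periodic_entry_values[OF 1])
        (simp add: cancel_self field_simps)
    ultimately show ?thesis
      using e M_mat_subword_0[OF 1, of k] unfolding r_eq
      by (elim disjE conjE) (simp_all only: add_0_right zero_neq_one not_False_eq_True)
  next
    case 2
    have "M_mat (subword i (3 * k + 1)) $ 1 $ 1 = inverse t ^ (k + 1)"
      using M_mat_subword_1[OF 2, of k] t_nonzero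
      by (simp only: M_mat_subword_add periodic_entry_values[OF 2])
        (simp add: cancel_self field_simps)
    moreover have "M_mat (subword i (3 * k + 2)) $ 1 $ 1 = 0"
      using M_mat_subword_1[OF 2, of k] t_nonzero
      by (simp only: M_mat_subword_add periodic_entry_values[OF 2])
        (simp add: cancel_self field_simps)
    ultimately show ?thesis
      using e M_mat_subword_1[OF 2, of k] unfolding r_eq
      by (elim disjE conjE) (simp_all only: add_0_right zero_neq_one not_False_eq_True)
  next
    case 3
    have "M_mat (subword i (3 * k + 1)) $ 1 $ 1 = t ^ (k + 1)"
      using M_mat_subword_2[OF 3, of k] t_nonzero
      by (simp only: M_mat_subword_add periodic_entry_values[OF 3])
        (simp add: cancel_self field_simps)
    \<comment> \<open>The mixed value arises only for this start and length.\<close>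
    moreover have "M_mat (subword i (3 * k + 2)) $ 1 $ 1 = t * (t ^ (k + 1) + inverse t ^ (k + 1))"
      using M_mat_subword_2[OF 3, of k] t_nonzero
      by (simp only: M_mat_subword_add periodic_entry_values[OF 3])
        (simp add: cancel_self field_simps)
    ultimately show ?thesis
      using e M_mat_subword_2[OF 3, of k] mixed_neq[of "k + 1"] unfolding r_eq
      by (elim disjE conjE) (simp_all only: add_0_right zero_neq_one not_False_eq_True)
  qed
qed

end

section \<open>Irreducibility of the periodic tuple and the lower bound\<close>

theorem theorem6p12:
  fixes n :: nat
  assumes "odd n" and "n \<noteq> 1"
    and "squarefree (2 ^ n - 1 :: nat)"
    and "CARD('a::{field, finite}) = 2 ^ n"
  shows "max_irreducible_size TYPE('a) \<ge> 3 * (2 ^ n - 1)"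
proof -
  define m :: nat where "m = 2 ^ n - 1"
  have n0: "n > 0" using assms(1) by (rule odd_pos)
  then have "(2 :: nat) ^ 1 \<le> 2 ^ n" by (intro power_increasing) auto
  then have m0: "m > 0" by (simp add: m_def)
  obtain t :: 'a where t: "has_mult_order t m" "\<And>y. y\<^sup>2 + y \<noteq> t\<^sup>2"
    using exists_maximal_order_not_artin_schreier[OF assms(4,1,3)] unfolding m_def by blast
  interpret char_2_period t
  proof
    show "(1 + 1 :: 'a) = 0"
      by (rule finite_field_even_card_imp_char_2) (use assms(4) n0 in simp)
    show "t \<noteq> 0" using t(2)[of 0] by auto
  qed
  define c where "c = subword 0 (3 * m)"
  have len: "length c = 3 * m" by (simp add: c_def subword_def)
  have c: "quiddity c"
    unfolding c_def using t(1) by (intro quiddity_subword) (simp add: has_mult_order_def)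
  have "\<not> reducible_quiddity c"
  proof
    assume "reducible_quiddity c"
    then obtain a b where b: "quiddity b" "length b \<ge> 3" and a: "length a \<ge> 3"
      and equiv: "tuple_equiv c (tuple_sum a b)"
      unfolding reducible_quiddity_def by blast
    have "rev c = c"
      by (simp add: c_def subword_def rev_periodic_entries)
    then obtain k where k: "tuple_sum a b = rotate k c"
      using equiv unfolding tuple_equiv_def by auto
    \<comment> \<open>\<open>p\<close> is \<open>a\<close> with its two ends altered; what follows
      it in the sum is the interior of \<open>b\<close>.\<close>
    define p where "p = [hd a + last b] @ butlast (tl a) @ [last a + hd b]"
    have p: "length p = length a" using a by (simp add: p_def)
    have "p @ butlast (tl b) = subword k (3 * m)"
      using k by (simp add: p_def tuple_sum_def c_def subword_def rotate_periodic_entries)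
    moreover have "length (subword k (3 * m)) = 3 * m"
      by (simp add: subword_def)
    ultimately have l: "length a + (length b - 2) = 3 * m"
      and "butlast (tl b) = drop (length a) (subword k (3 * m))"
      using p by (metis length_append length_butlast length_tl diff_diff_left one_add_one,
          metis append_eq_conv_conj)
    then have w: "butlast (tl b) = subword (k + length a) (3 * m - length a)"
      by (simp add: subword_def drop_map)
    have "M_mat (butlast (tl b)) $ 1 $ 1 = 1"
      using quiddity_interior[OF b(1)] b(2) minus_eq[of 1] by auto
    moreover have "M_mat (butlast (tl b)) $ 1 $ 1 \<noteq> 1"
      \<comment> \<open>The interior is nonempty since \<open>length b \<ge> 3\<close>, and at least
        3 short of the whole since \<open>length a \<ge> 3\<close>.\<close>
      unfolding w using l a b(2) by (intro M_mat_subword_neq_1[OF t]) auto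
    ultimately show False by simp
  qed
  then have "irreducible_quiddity c"
    using c m0 len by (simp add: irreducible_quiddity_def)
  then show ?thesis
    using length_irreducible_quiddity_le_max[of c] len by (simp add: m_def)
qed

end
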